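(* Let $X$ be a metric measure space with doubling measure $\mu$ (doubling constant $C_\mu$). (i) Let $f$ be a nonnegative strongly harmonic function on an open set $\Omega\subset X$. Suppose a ball $B:=B(x,r)\subset\Omega$ is such that $B(x,6r)\Subset\Omega$. Then $\sup_B f\le C_H\inf_B f$ with $C_H=C_\mu^3$. (ii) Let $f$ be a nonnegative weakly harmonic function on a domain $\Omega\subset X$. Suppose a ball $B:=B(x,r)\subset B(x,2r^B_M)\Subset\Omega$ is such that $$0<r^B_m\le\sup_{y\in B}r^y_m<r<3r<\inf_{y\in B}r^y_M\le r^B_M.$$ Then $\sup_B f\le C_H\inf_B f$ with $C_H=C_\mu^{\log_2\frac{5r^B_M}{3r^B_m}+1}$.
   Context: Standing assumptions: $\mu$ is Borel regular, $0<\mu(B)<\infty$ for every ball $B$, and $X$ is proper. $B(x,r)$ is the open ball; $A\Subset\Omega$ means that the closure of $A$ is a compact subset of $\Omega$; a domain is an open connected set. $\mu$ is doubling with constant $C_\mu$ if $\mu(B(x,2r))\le C_\mu\mu(B(x,r))$ for all balls. A locally integrable $f:\Omega\to\mathbb{R}$ is strongly harmonic in an open set $\Omega$ if $f(x)=\frac{1}{\mu(B(x,r))}\int_{B(x,r)}f\,d\mu$ for all $x\in\Omega$, $r>0$ with $B(x,r)\Subset\Omega$. It is weakly harmonic if for every $x\in\Omega$ there is a non-empty, at most countable set $\{r^x_1,r^x_2,\ldots\}$ of positive radii (admissible radii at $x$) with $B(x,r^x_i)\Subset\Omega$ and the mean value identity holding on each $B(x,r^x_i)$. Put $r^x_M=\sup_i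 r^x_i$, $r^x_m=\inf_i r^x_i$, and for a set $E$, $r^E_M=\sup_{x\in E}r^x_M$, $r^E_m=\inf_{x\in E}r^x_m$. *)

theory Defs
  imports "HOL-Analysis.Analysis"
begin

text \<open>
  The measures below are countably additive measures on a sigma-algebra which contains the Borel
  sets but may be larger. A Borel regular outer measure gives such a measure by restriction to
  its Caratheodory-measurable sets.
\<close>

definition borel_regular :: "'a::metric_space measure \<Rightarrow> bool" where
  "borel_regular M \<longleftrightarrow>
     space M = UNIV \<and> sets borel \<subseteq> sets M \<and>
     (\<forall>A\<in>sets M. \<exists>E\<in>sets borel. A \<subseteq> E \<and> emeasure M E = emeasure M A)"

definition positive_finite_balls :: "'a::metric_space measure \<Rightarrow> bool" where
  "positive_finite_balls M \<longleftrightarrow>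
     (\<forall>x. \<forall>r>0. 0 < emeasure M (ball x r) \<and> emeasure M (ball x r) < \<infinity>)"

definition doubling :: "'a::metric_space measure \<Rightarrow> real \<Rightarrow> bool" where
  "doubling M C \<longleftrightarrow>
     (\<forall>x. \<forall>r>0. emeasure M (ball x (2 * r)) \<le> ennreal C * emeasure M (ball x r))"

definition compactly_contained :: "'a::metric_space set \<Rightarrow> 'a set \<Rightarrow> bool" where
  "compactly_contained A \<Omega> \<longleftrightarrow> compact (closure A) \<and> closure A \<subseteq> \<Omega>"

text \<open>
  Functions on an open set \<open>\<Omega>\<close> are total functions; no definition depends on their values
  outside \<open>\<Omega>\<close>.
\<close>

definition locally_integrable_on ::
    "'a::metric_space measure \<Rightarrow> 'a set \<Rightarrow> ('a \<Rightarrow> real) \<Rightarrow> bool" where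
  "locally_integrable_on M \<Omega> f \<longleftrightarrow>
     (\<forall>x\<in>\<Omega>. \<exists>r>0. ball x r \<subseteq> \<Omega> \<and> set_integrable M (ball x r) f)"

definition mean_value_property ::
    "'a::metric_space measure \<Rightarrow> ('a \<Rightarrow> real) \<Rightarrow> 'a \<Rightarrow> real \<Rightarrow> bool" where
  "mean_value_property M f x r \<longleftrightarrow>
     f x = 1 / measure M (ball x r) * (LINT y:ball x r|M. f y)"

definition strongly_harmonic ::
    "'a::metric_space measure \<Rightarrow> 'a set \<Rightarrow> ('a \<Rightarrow> real) \<Rightarrow> bool" where
  "strongly_harmonic M \<Omega> f \<longleftrightarrow>
     open \<Omega> \<and> locally_integrable_on M \<Omega> f \<and>
     (\<forall>x\<in>\<Omega>. \<forall>r>0. compactly_contained (ball x r) \<Omega> \<longrightarrow> mean_value_property M f x r)"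

text \<open>
  The radii of a weakly harmonic function are data, not determined by the function:
  \<open>R x\<close> is the chosen set of admissible radii at \<open>x\<close>.
\<close>

definition weakly_harmonic_with ::
    "'a::metric_space measure \<Rightarrow> 'a set \<Rightarrow> ('a \<Rightarrow> real) \<Rightarrow> ('a \<Rightarrow> real set) \<Rightarrow> bool" where
  "weakly_harmonic_with M \<Omega> f R \<longleftrightarrow>
     open \<Omega> \<and> locally_integrable_on M \<Omega> f \<and>
     (\<forall>x\<in>\<Omega>. R x \<noteq> {} \<and> countable (R x) \<and>
        (\<forall>r\<in>R x. 0 < r \<and> compactly_contained (ball x r) \<Omega> \<and> mean_value_property M f x r))"

text \<open>
  Real-valued suprema: these are meaningful only for bounded families of radii, so
  boundedness has to be assumed wherever \<open>rad_sup_on\<close> is used.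
\<close>

definition rad_sup :: "('a \<Rightarrow> real set) \<Rightarrow> 'a \<Rightarrow> real" where
  "rad_sup R x = Sup (R x)"

definition rad_inf :: "('a \<Rightarrow> real set) \<Rightarrow> 'a \<Rightarrow> real" where
  "rad_inf R x = Inf (R x)"

definition rad_sup_on :: "('a \<Rightarrow> real set) \<Rightarrow> 'a set \<Rightarrow> real" where
  "rad_sup_on R E = (SUP x\<in>E. rad_sup R x)"

definition rad_inf_on :: "('a \<Rightarrow> real set) \<Rightarrow> 'a set \<Rightarrow> real" where
  "rad_inf_on R E = (INF x\<in>E. rad_inf R x)"

text \<open>
  \<open>sup f \<le> C inf f\<close> on \<open>B\<close>, with extended real bounds: for nonnegative \<open>f\<close> and nonempty
  \<open>B\<close> the right-hand side is finite, so boundedness of \<open>f\<close> on \<open>B\<close> is part of the claim.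
\<close>

definition harnack_on :: "'a set \<Rightarrow> ('a \<Rightarrow> real) \<Rightarrow> real \<Rightarrow> bool" where
  "harnack_on B f C \<longleftrightarrow>
     (SUP y\<in>B. ereal (f y)) \<le> ereal C * (INF y\<in>B. ereal (f y))"

end

theory Submission
  imports Defs
begin

text \<open>
  For \<open>y, z \<in> B(x,r)\<close> choose radii \<open>s\<close> and \<open>t\<close> at which the mean value property holds at \<open>y\<close> and
  \<open>z\<close>, with \<open>s \<le> r\<close> and \<open>t \<ge> 3r\<close>. Then \<open>B(y,s) \<subseteq> B(z,t) \<subseteq> B(y,5t/3)\<close>, so nonnegativity gives
  \<open>\<mu>(B(y,s)) f(y) \<le> \<mu>(B(z,t)) f(z)\<close>, and iterated doubling bounds the ratio of the two measures.
\<close>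

section \<open>Harnack bounds, compact containment and integrability\<close>

lemma harnack_onI:
  assumes "0 < C" "\<And>y z. y \<in> B \<Longrightarrow> z \<in> B \<Longrightarrow> f y \<le> C * f z"
  shows "harnack_on B f C"
  unfolding harnack_on_def
proof (rule SUP_least)
  fix y assume y: "y \<in> B"
  \<comment> \<open>Division by \<open>C\<close> turns the pairwise estimate into a lower bound for
    the values, which passes to the extended-real infimum without asking whether it is
    finite.\<close>
  have "ereal (f y / C) \<le> (INF z\<in>B. ereal (f z))"
    using assms y by (intro INF_greatest) (simp add: field_simps)
  then have "ereal C * ereal (f y / C) \<le> ereal C * (INF z\<in>B. ereal (f z))"
    using assms(1) by (intro ereal_mult_left_mono) auto
  then show "ereal (f y) \<le> ereal C * (INF z\<in>B. ereal (f z))"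
    using assms(1) by simp
qed

lemma compactly_contained_subset:
  assumes "compactly_contained B \<Omega>" "A \<subseteq> B"
  shows "compactly_contained A \<Omega>"
proof -
  have "closure A \<subseteq> closure B"
    using assms(2) by (rule closure_mono)
  then have "compact (closure A)"
    using assms(1) compact_Int_closed[of "closure B" "closure A"]
    by (simp add: compactly_contained_def Int_absorb1)
  with \<open>closure A \<subseteq> closure B\<close> show ?thesis
    using assms(1) by (auto simp: compactly_contained_def)
qed

text \<open>Finitely many balls of integrability cover the compact closure; integrability passes to
  their union and from there down to the measurable set \<open>A\<close>.\<close>

lemma locally_integrable_on_imp_set_integrable:
  fixes M :: "'a::metric_space measure"
  assumes "sets borel \<subseteq> sets M" "locally_integrable_on M \<Omega> f"
    and "compactly_contained A \<Omega>" "A \<in> sets M"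
  shows "set_integrable M A f"
proof -
  obtain \<rho> where \<rho>: "\<And>x. x \<in> \<Omega> \<Longrightarrow> 0 < \<rho> x \<and> set_integrable M (ball x (\<rho> x)) f"
    using assms(2) unfolding locally_integrable_on_def by metis
  have A: "compact (closure A)" "closure A \<subseteq> \<Omega>"
    using assms(3) by (auto simp: compactly_contained_def)
  obtain D where D: "D \<subseteq> closure A" "finite D" "closure A \<subseteq> (\<Union>x\<in>D. ball x (\<rho> x))"
  proof (rule compactE_image[OF A(1), of "closure A" "\<lambda>x. ball x (\<rho> x)"])
    show "closure A \<subseteq> (\<Union>x\<in>closure A. ball x (\<rho> x))"
      using A(2) \<rho> by force
  qed auto
  have "set_integrable M (\<Union>x\<in>D. ball x (\<rho> x)) f"
    using D A(2) \<rho> assms(1) by (intro set_integrable_UN) (auto simp: subset_iff)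
  then show ?thesis
    by (rule set_integrable_subset) (use assms(4) D(3) closure_subset[of A] in auto)
qed

lemma set_integral_mono_set:
  fixes f :: "'a \<Rightarrow> real"
  assumes "set_integrable M B f" "A \<in> sets M" "A \<subseteq> B" "\<And>x. x \<in> B \<Longrightarrow> 0 \<le> f x"
  shows "(LINT x:A|M. f x) \<le> (LINT x:B|M. f x)"
  unfolding set_lebesgue_integral_def
proof (rule integral_mono)
  show "integrable M (\<lambda>x. indicator A x *\<^sub>R f x)"
    using set_integrable_subset[OF assms(1-3)] by (simp add: set_integrable_def)
  show "integrable M (\<lambda>x. indicator B x *\<^sub>R f x)"
    using assms(1) by (simp add: set_integrable_def)
  show "indicator A x *\<^sub>R f x \<le> indicator B x *\<^sub>R f x" for x
    using assms(3,4) by (auto simp: indicator_def)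
qed

section \<open>Doubling measures and comparison of mean values\<close>

lemma positive_finite_ballsD:
  assumes "positive_finite_balls M" "0 < r"
  shows "emeasure M (ball x r) = ennreal (measure M (ball x r))" "0 < measure M (ball x r)"
proof -
  have *: "0 < emeasure M (ball x r)" "emeasure M (ball x r) < \<infinity>"
    using assms by (auto simp: positive_finite_balls_def)
  show "emeasure M (ball x r) = ennreal (measure M (ball x r))"
    using *(2) by (intro emeasure_eq_ennreal_measure) auto
  with *(1) show "0 < measure M (ball x r)"
    by simp
qed

text \<open>Doubling the radius cannot decrease the measure of a ball, and this measure is positive
  and finite, so it cancels.\<close>

lemma doubling_constant_ge_1:
  fixes M :: "'a::metric_space measure"
  assumes "sets borel \<subseteq> sets M" "positive_finite_balls M" "doubling M C"
  shows "1 \<le> C"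
proof -
  \<comment> \<open>Types are inhabited, so there is a ball to test; any centre and radius would
    do.\<close>
  fix x :: 'a
  let ?m = "measure M (ball x 1)"
  have m: "emeasure M (ball x 1) = ennreal ?m" "0 < ?m"
    using positive_finite_ballsD[OF assms(2), of 1] by auto
  have "emeasure M (ball x 1) \<le> emeasure M (ball x (2 * 1))"
    using assms(1) by (intro emeasure_mono) auto
  also have "\<dots> \<le> ennreal C * emeasure M (ball x 1)"
    using assms(3) unfolding doubling_def by (metis zero_less_one)
  finally have le: "ennreal ?m \<le> ennreal C * ennreal ?m"
    by (simp add: m(1))
  \<comment> \<open>\<open>ennreal C\<close> is 0 for nonpositive \<open>C\<close>, which would
    force the positive number \<open>?m\<close> to vanish. The sign of \<open>C\<close> has to be
    settled before the product can be read in the reals.\<close>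
  have "0 < C"
    by (rule ccontr) (use le m(2) in \<open>simp add: ennreal_neg\<close>)
  with le m(2) show ?thesis
    by (simp add: ennreal_mult[symmetric])
qed

lemma measure_ball_pow2_le:
  fixes M :: "'a::metric_space measure"
  assumes "positive_finite_balls M" "doubling M C" "0 \<le> C" "0 < s"
  shows "measure M (ball y (2 ^ n * s)) \<le> C ^ n * measure M (ball y s)"
proof (induction n)
  case (Suc n)
  have pos: "0 < 2 ^ n * s"
    using assms(4) by simp
  have "emeasure M (ball y (2 * (2 ^ n * s))) \<le> ennreal C * emeasure M (ball y (2 ^ n * s))"
    using assms(2) pos unfolding doubling_def by blast
  then have "measure M (ball y (2 * (2 ^ n * s))) \<le> C * measure M (ball y (2 ^ n * s))"
    using assms(3) pos by (simp add: positive_finite_ballsD(1)[OF assms(1)] ennreal_mult[symmetric])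
  also have "\<dots> \<le> C * (C ^ n * measure M (ball y s))"
    using Suc assms(3) by (rule mult_left_mono)
  finally show ?case
    by (simp add: mult_ac)
qed simp

text \<open>Core of both Harnack inequalities, which differ only in the radii and in
  \<open>n\<close>. The first inclusion compares the integrals, by nonnegativity on the larger ball;
  the second compares the measures, \<open>n\<close> doublings of \<open>ball y s\<close> costing
  the factor \<open>C ^ n\<close>.\<close>

lemma mean_value_comparison:
  fixes M :: "'a::metric_space measure"
  assumes M: "sets borel \<subseteq> sets M" "positive_finite_balls M" "doubling M C"
    and f: "locally_integrable_on M \<Omega> f" "\<And>x. x \<in> \<Omega> \<Longrightarrow> 0 \<le> f x"
    and mv: "mean_value_property M f y s" "mean_value_property M f z t"
    and "0 < s" "0 < t" "compactly_contained (ball z t) \<Omega>"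
    and sub: "ball y s \<subseteq> ball z t" "ball z t \<subseteq> ball y (2 ^ n * s)"
  shows "f y \<le> C ^ n * f z"
proof -
  let ?my = "measure M (ball y s)" and ?mz = "measure M (ball z t)"
  have ball_sets: "ball u \<rho> \<in> sets M" for u \<rho>
    using M(1) by auto
  have pos: "0 < ?my" "0 < ?mz"
    using positive_finite_ballsD(2) M(2) \<open>0 < s\<close> \<open>0 < t\<close> by blast+
  have C: "1 \<le> C"
    using doubling_constant_ge_1[OF M] .
  have "ball z t \<subseteq> \<Omega>"
    using \<open>compactly_contained (ball z t) \<Omega>\<close> closure_subset[of "ball z t"]
    by (auto simp: compactly_contained_def)
  then have fz: "0 \<le> f z"
    using f(2) \<open>0 < t\<close> by (metis centre_in_ball subsetD)
  have "?my * f y = (LINT u:ball y s|M. f u)"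
    using mv(1) pos unfolding mean_value_property_def by simp
  also have "\<dots> \<le> (LINT u:ball z t|M. f u)"
  proof (rule set_integral_mono_set)
    show "set_integrable M (ball z t) f"
      using M(1) f(1) \<open>compactly_contained (ball z t) \<Omega>\<close> ball_sets
      by (rule locally_integrable_on_imp_set_integrable)
  qed (use ball_sets sub \<open>ball z t \<subseteq> \<Omega>\<close> f(2) in auto)
  also have "\<dots> = ?mz * f z"
    using mv(2) pos unfolding mean_value_property_def by simp
  also have "\<dots> \<le> (C ^ n * ?my) * f z"
  proof (rule mult_right_mono[OF _ fz])
    have "emeasure M (ball z t) \<le> emeasure M (ball y (2 ^ n * s))"
      using sub(2) ball_sets by (rule emeasure_mono)
    then have "?mz \<le> measure M (ball y (2 ^ n * s))"
      using \<open>0 < s\<close> \<open>0 < t\<close> by (simp add: positive_finite_ballsD(1)[OF M(2)])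
    also have "\<dots> \<le> C ^ n * ?my"
      using measure_ball_pow2_le[OF M(2,3)] C \<open>0 < s\<close> by simp
    finally show "?mz \<le> C ^ n * ?my" .
  qed
  finally have "?my * f y \<le> ?my * (C ^ n * f z)"
    by (simp add: mult_ac)
  then show ?thesis
    using pos(1) by simp
qed

section \<open>Choice of radii and the two Harnack inequalities\<close>

lemma ball_subset_ball:
  assumes "dist x y + r \<le> s"
  shows "ball x r \<subseteq> ball y s"
proof
  fix u assume "u \<in> ball x r"
  then show "u \<in> ball y s"
    using assms dist_triangle[of y u x] by (simp add: dist_commute)
qed

lemma dist_less_double_radius:
  assumes "y \<in> ball x r" "z \<in> ball x r"
  shows "dist y z < 2 * r"
  using assms dist_triangle2[of y z x] by (simp add: dist_commute)

text \<open>Every radius up to \<open>3 * r\<close> is admissible at points of the ball, so the two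
  radii can be fixed in advance and the exponent is a number.\<close>

lemma strongly_harmonic_harnack:
  fixes M :: "'a::metric_space measure"
  assumes M: "sets borel \<subseteq> sets M" "positive_finite_balls M" "doubling M C"
    and f: "strongly_harmonic M \<Omega> f" "\<And>x. x \<in> \<Omega> \<Longrightarrow> 0 \<le> f x"
    and "0 < r" "compactly_contained (ball x (6 * r)) \<Omega>"
  shows "harnack_on (ball x r) f (C ^ 3)"
proof (rule harnack_onI)
  show "0 < C ^ 3"
    using doubling_constant_ge_1[OF M] by simp
next
  fix y z assume yz: "y \<in> ball x r" "z \<in> ball x r"
  then have d: "dist y z < 2 * r"
    by (rule dist_less_double_radius)
  \<comment> \<open>Such a ball stays within distance \<open>r + 3 * r\<close> of \<open>x\<close>,
    hence inside \<open>ball x (6 * r)\<close>.\<close>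
  have cc: "compactly_contained (ball u \<rho>) \<Omega>" if "u \<in> ball x r" "\<rho> \<le> 3 * r" for u \<rho>
  proof (rule compactly_contained_subset[OF assms(7)])
    show "ball u \<rho> \<subseteq> ball x (6 * r)"
      using that \<open>0 < r\<close> by (intro ball_subset_ball) (simp add: dist_commute)
  qed
  have "u \<in> \<Omega>" if "u \<in> ball x r" for u
    using cc[OF that, of r] \<open>0 < r\<close> closure_subset[of "ball u r"]
    by (force simp: compactly_contained_def)
  then have mv: "mean_value_property M f u \<rho>" if "u \<in> ball x r" "0 < \<rho>" "\<rho> \<le> 3 * r" for u \<rho>
    using f(1) cc that by (auto simp: strongly_harmonic_def)
  show "f y \<le> C ^ 3 * f z"
  proof (rule mean_value_comparison[OF M _ f(2)])
    show "locally_integrable_on M \<Omega> f"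
      using f(1) by (simp add: strongly_harmonic_def)
    show "mean_value_property M f y r" "mean_value_property M f z (3 * r)"
      using mv yz \<open>0 < r\<close> by auto
    show "compactly_contained (ball z (3 * r)) \<Omega>"
      using cc yz by auto
    \<comment> \<open>The radii \<open>r\<close> and \<open>3 * r\<close> fit because the centres
      are less than \<open>2 * r\<close> apart: \<open>2 * r + r = 3 * r\<close>, and
      \<open>2 * r + 3 * r = 5 * r\<close>, which three doublings of \<open>r\<close>
      exceed.\<close>
    show "ball y r \<subseteq> ball z (3 * r)"
      using d by (intro ball_subset_ball) (simp add: dist_commute)
    show "ball z (3 * r) \<subseteq> ball y (2 ^ 3 * r)"
      using d \<open>0 < r\<close> by (intro ball_subset_ball) (simp add: dist_commute)
  qed (use \<open>0 < r\<close> in auto)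
qed

text \<open>The radii cannot be prescribed here: there is only some radius below \<open>r\<close> at
  one point and some radius above \<open>3 * r\<close> at the other. Their ratio is controlled by
  the extreme radii over the ball, whence the logarithm in the exponent.\<close>

lemma weakly_harmonic_harnack:
  fixes M :: "'a::metric_space measure"
  assumes M: "sets borel \<subseteq> sets M" "positive_finite_balls M" "doubling M C"
    and f: "weakly_harmonic_with M \<Omega> f R" "\<And>x. x \<in> \<Omega> \<Longrightarrow> 0 \<le> f x"
    and "0 < r" "ball x r \<subseteq> \<Omega>"
    and bdd: "bdd_above (\<Union>y\<in>ball x r. R y)"
    and inf_pos: "0 < rad_inf_on R (ball x r)"
    and small: "(SUP y\<in>ball x r. rad_inf R y) < r"
    and large: "3 * r < (INF y\<in>ball x r. rad_sup R y)"
  shows "harnack_on (ball x r) f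
    (C powr (log 2 (5 * rad_sup_on R (ball x r) / (3 * rad_inf_on R (ball x r))) + 1))"
proof -
  let ?B = "ball x r"
  define a where "a = rad_inf_on R ?B"
  define b where "b = rad_sup_on R ?B"
  \<comment> \<open>Real \<open>Sup\<close> and \<open>Inf\<close> are informative only for bounded
    families; \<open>K\<close> from above and 0 from below supply the bounds for all radii used
    here.\<close>
  obtain K where K: "\<And>y \<rho>. y \<in> ?B \<Longrightarrow> \<rho> \<in> R y \<Longrightarrow> \<rho> \<le> K"
    using bdd unfolding bdd_above_def by blast
  have R: "R y \<noteq> {}" "\<And>\<rho>. \<rho> \<in> R y \<Longrightarrow> 0 < \<rho>"
    "\<And>\<rho>. \<rho> \<in> R y \<Longrightarrow> compactly_contained (ball y \<rho>) \<Omega>"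
    "\<And>\<rho>. \<rho> \<in> R y \<Longrightarrow> mean_value_property M f y \<rho>" if "y \<in> ?B" for y
    using f(1) that \<open>?B \<subseteq> \<Omega>\<close> by (auto simp: weakly_harmonic_with_def)
  have bb: "bdd_below (R y)" "bdd_above (R y)" if "y \<in> ?B" for y
    using R(2) K that by (meson bdd_belowI less_imp_le, meson bdd_aboveI)
  have inf_ge: "0 \<le> rad_inf R y" if "y \<in> ?B" for y
    unfolding rad_inf_def using R(1,2)[OF that] by (meson cInf_greatest less_imp_le)
  have sup_le: "rad_sup R y \<le> K" if "y \<in> ?B" for y
    unfolding rad_sup_def using R(1)[OF that] K that by (meson cSup_least)
  have inf_le_sup: "rad_inf R y \<le> rad_sup R y" if "y \<in> ?B" for y
    unfolding rad_inf_def rad_sup_def using R(1) bb that by (intro cInf_le_cSup) auto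
  have bounds: "a \<le> \<rho>" "\<rho> \<le> b" if "y \<in> ?B" "\<rho> \<in> R y" for y \<rho>
  proof -
    have "a \<le> rad_inf R y"
      unfolding a_def rad_inf_on_def using that inf_ge
      by (intro cINF_lower bdd_belowI2[where m = 0]) auto
    also have "\<dots> \<le> \<rho>"
      unfolding rad_inf_def using that bb by (intro cInf_lower) auto
    finally show "a \<le> \<rho>" .
    have "\<rho> \<le> rad_sup R y"
      unfolding rad_sup_def using that bb by (intro cSup_upper) auto
    also have "\<dots> \<le> b"
      unfolding b_def rad_sup_on_def using that sup_le
      by (intro cSUP_upper bdd_aboveI2[where M = K]) auto
    finally show "\<rho> \<le> b" .
  qed
  \<comment> \<open>The extremal radii need not be attained, but an infimum strictly below
    \<open>r\<close> is undercut by an actual radius. The next claim is the dual one for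
    suprema.\<close>
  have ex_small: "\<exists>s\<in>R y. s < r" if "y \<in> ?B" for y
  proof -
    have "rad_inf R y \<le> (SUP y\<in>?B. rad_inf R y)"
      using that inf_le_sup sup_le
      by (intro cSUP_upper bdd_aboveI2[where M = K]) (auto intro: order_trans)
    then have "Inf (R y) < r"
      using small by (simp add: rad_inf_def)
    then show ?thesis
      using cInf_less_iff[OF R(1) bb(1)] that by blast
  qed
  have ex_large: "\<exists>t\<in>R z. 3 * r < t" if "z \<in> ?B" for z
  proof -
    have "(INF y\<in>?B. rad_sup R y) \<le> rad_sup R z"
      using that inf_le_sup inf_ge
      by (intro cINF_lower bdd_belowI2[where m = 0]) (auto intro: order_trans)
    then have "3 * r < Sup (R z)"
      using large by (simp add: rad_sup_def)
    then show ?thesis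
      using less_cSup_iff[OF R(1) bb(2)] that by blast
  qed
  have C: "1 \<le> C"
    using doubling_constant_ge_1[OF M] .
  have "0 < a"
    using inf_pos by (simp add: a_def)
  have "0 < b"
    using ex_large[of x] bounds(2)[of x] \<open>0 < r\<close> by force
  \<comment> \<open>Chosen so that \<open>q * a = 5 / 3 * b\<close>, a bound for the radius around
    \<open>y\<close> that must be reached from some \<open>s \<ge> a\<close>. With \<open>n\<close>
    the rounded-up logarithm, \<open>n\<close> doublings suffice.\<close>
  define q where "q = 5 * b / (3 * a)"
  define n where "n = nat \<lceil>log 2 q\<rceil>"
  have "0 < q"
    using \<open>0 < a\<close> \<open>0 < b\<close> by (simp add: q_def)
  have "log 2 q \<le> real n"
    unfolding n_def by linarith
  then have "2 powr (log 2 q) \<le> 2 powr (real n)"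
    by simp
  then have q_le: "q \<le> 2 ^ n"
    using \<open>0 < q\<close> by (simp add: powr_realpow)
  \<comment> \<open>This gives \<open>q \<ge> 1\<close>, so the logarithm is nonnegative and
    \<open>nat\<close> truncates nothing; rounding up then costs at most 1, the summand in the
    exponent.\<close>
  have "a \<le> b"
    using ex_large[of x] bounds[of x] \<open>0 < r\<close> by force
  then have "1 \<le> q"
    using \<open>0 < a\<close> by (simp add: q_def field_simps)
  then have n_le: "real n \<le> log 2 q + 1"
    unfolding n_def by simp
  have "harnack_on ?B f (C powr (log 2 q + 1))"
  proof (rule harnack_onI)
    show "0 < C powr (log 2 q + 1)"
      using C by simp
  next
    fix y z assume yz: "y \<in> ?B" "z \<in> ?B"
    then have d: "dist y z < 2 * r"
      by (rule dist_less_double_radius)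
    obtain s where s: "s \<in> R y" "s < r"
      using ex_small yz by blast
    obtain t where t: "t \<in> R z" "3 * r < t"
      using ex_large yz by blast
    have "f y \<le> C ^ n * f z"
    proof (rule mean_value_comparison[OF M _ f(2)])
      show "locally_integrable_on M \<Omega> f"
        using f(1) by (simp add: weakly_harmonic_with_def)
      \<comment> \<open>\<open>dist y z + s < 2 * r + r = 3 * r < t\<close>.\<close>
      show "ball y s \<subseteq> ball z t"
        using d s t by (intro ball_subset_ball) (simp add: dist_commute)
      \<comment> \<open>From \<open>3 * r < t\<close> the distance is below
        \<open>2 * r < 2 / 3 * t\<close>; this is the source of the factor 5/3.\<close>
      have "dist y z + t \<le> 5 / 3 * t"
        using d t by simp
      also have "\<dots> \<le> 5 / 3 * b"
        using bounds(2)[OF yz(2) t(1)] by simp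
      also have "\<dots> = q * a"
        using \<open>0 < a\<close> by (simp add: q_def)
      also have "\<dots> \<le> 2 ^ n * s"
        using q_le bounds(1)[OF yz(1) s(1)] \<open>0 < a\<close> by (intro mult_mono) auto
      finally show "ball z t \<subseteq> ball y (2 ^ n * s)"
        by (intro ball_subset_ball) (simp add: dist_commute)
    qed (use R yz s t in auto)
    also have "\<dots> \<le> C powr (log 2 q + 1) * f z"
    proof (rule mult_right_mono)
      have "C ^ n = C powr real n"
        using C by (simp add: powr_realpow)
      \<comment> \<open>Raising the exponent is harmless because \<open>C \<ge> 1\<close>.\<close>
      also have "\<dots> \<le> C powr (log 2 q + 1)"
        using n_le C by (rule powr_mono)
      finally show "C ^ n \<le> C powr (log 2 q + 1)" .
      show "0 \<le> f z"
        using f(2) yz \<open>?B \<subseteq> \<Omega>\<close> by blast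
    qed
    finally show "f y \<le> C powr (log 2 q + 1) * f z" .
  qed
  then show ?thesis
    by (simp add: q_def a_def b_def)
qed

theorem lemma4p1:
  fixes M :: "'a::heine_borel measure" and C :: real
  assumes "borel_regular M"
    and "positive_finite_balls M"
    and "doubling M C"
  shows "(\<forall>(\<Omega>::'a set) (f::'a \<Rightarrow> real) (x::'a) (r::real).
            open \<Omega> \<longrightarrow> strongly_harmonic M \<Omega> f \<longrightarrow> (\<forall>y\<in>\<Omega>. 0 \<le> f y) \<longrightarrow>
            0 < r \<longrightarrow> ball x r \<subseteq> \<Omega> \<longrightarrow> compactly_contained (ball x (6 * r)) \<Omega> \<longrightarrow>
            harnack_on (ball x r) f (C ^ 3))
       \<and> (\<forall>(\<Omega>::'a set) (f::'a \<Rightarrow> real) (R::'a \<Rightarrow> real set) (x::'a) (r::real).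
            open \<Omega> \<longrightarrow> connected \<Omega> \<longrightarrow> weakly_harmonic_with M \<Omega> f R \<longrightarrow> (\<forall>y\<in>\<Omega>. 0 \<le> f y) \<longrightarrow>
            0 < r \<longrightarrow>
            bdd_above (\<Union>y\<in>ball x r. R y) \<longrightarrow>
            ball x r \<subseteq> ball x (2 * rad_sup_on R (ball x r)) \<longrightarrow>
            compactly_contained (ball x (2 * rad_sup_on R (ball x r))) \<Omega> \<longrightarrow>
            0 < rad_inf_on R (ball x r) \<longrightarrow>
            rad_inf_on R (ball x r) \<le> (SUP y\<in>ball x r. rad_inf R y) \<longrightarrow>
            (SUP y\<in>ball x r. rad_inf R y) < r \<longrightarrow>
            r < 3 * r \<longrightarrow>
            3 * r < (INF y\<in>ball x r. rad_sup R y) \<longrightarrow>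
            (INF y\<in>ball x r. rad_sup R y) \<le> rad_sup_on R (ball x r) \<longrightarrow>
            harnack_on (ball x r) f
              (C powr (log 2 (5 * rad_sup_on R (ball x r) / (3 * rad_inf_on R (ball x r))) + 1)))"
proof (intro conjI allI impI)
  have M: "sets borel \<subseteq> sets M"
    using assms(1) by (simp add: borel_regular_def)
  note harnack = strongly_harmonic_harnack[OF M assms(2,3)] weakly_harmonic_harnack[OF M assms(2,3)]
  {
    fix \<Omega> f and x :: 'a and r :: real
    assume "strongly_harmonic M \<Omega> f" "\<forall>y\<in>\<Omega>. 0 \<le> f y" "0 < r"
      "compactly_contained (ball x (6 * r)) \<Omega>"
    then show "harnack_on (ball x r) f (C ^ 3)"
      by (intro harnack(1)) auto
  next
    fix \<Omega> f R and x :: 'a and r :: real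
    assume *: "weakly_harmonic_with M \<Omega> f R" "\<forall>y\<in>\<Omega>. 0 \<le> f y" "0 < r"
      "bdd_above (\<Union>y\<in>ball x r. R y)"
      "ball x r \<subseteq> ball x (2 * rad_sup_on R (ball x r))"
      "compactly_contained (ball x (2 * rad_sup_on R (ball x r))) \<Omega>"
      "0 < rad_inf_on R (ball x r)"
      "(SUP y\<in>ball x r. rad_inf R y) < r"
      "3 * r < (INF y\<in>ball x r. rad_sup R y)"
    \<comment> \<open>The ball lies in the enclosing one, whose closure lies in
      \<open>\<Omega>\<close>.\<close>
    have "ball x r \<subseteq> \<Omega>"
      using *(5,6) closure_subset by (fastforce simp: compactly_contained_def)
    with * show "harnack_on (ball x r) f
        (C powr (log 2 (5 * rad_sup_on R (ball x r) / (3 * rad_inf_on R (ball x r))) + 1))"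
      by (intro harnack(2)[of \<Omega>]) auto
  }
qed

end
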